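(* Let $X$ be an absolutely continuous non-negative random variable with pdf $f$ and cdf $F$. If $IJ(t_1,t_2)$ is increasing in $t_2$ (that is, for any fixed $t_1$, $IJ(t_1,t_2)$ is increasing with respect to $t_2$), then $$IJ(t_1,t_2)\le -\frac{h_2(t_1,t_2)}{4}$$ for all $(t_1,t_2)\in D$.
   Context: Let $D=\{(u,v)\in\mathbb R_+^2: F(u)<F(v)\}$. For $(t_1,t_2)\in D$: - the interval extropy of $X$ is $IJ(t_1,t_2)=-\frac{1}{2(F(t_2)-F(t_1))^2}\int_{t_1}^{t_2} f^2(x)\,dx$; - the generalized failure rate functions of $X$ are $h_i(t_1,t_2)=\frac{f(t_i)}{F(t_2)-F(t_1)}$, $i=1,2$.
   Formalization: The pdf f is assumed to have, at each t > 0, a value not exceeding its essential upper limit at t (true if f is a one-sided derivative of F or one-sidedly continuous at t); for arbitrary versions the claim fails, e.g. uniform on [0,1] with f(1)=100. *)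

theory Defs
  imports "HOL-Probability.Probability"
begin

definition extropy_domain :: "(real \<Rightarrow> real) \<Rightarrow> (real \<times> real) set" where
  "extropy_domain F = {(u, v). 0 \<le> u \<and> 0 \<le> v \<and> F u < F v}"

text \<open>
  The square of a density need not be integrable, so the interval extropy is an extended real:
  it is minus infinity if the integral of the squared density over the interval diverges.
\<close>

definition interval_extropy :: "(real \<Rightarrow> real) \<Rightarrow> (real \<Rightarrow> real) \<Rightarrow> real \<Rightarrow> real \<Rightarrow> ereal" where
  "interval_extropy F f t1 t2 =
     - (ereal (1 / (2 * (F t2 - F t1)\<^sup>2)) *
        enn2ereal (\<integral>\<^sup>+x\<in>{t1..t2}. ennreal ((f x)\<^sup>2) \<partial>lborel))"

definition failure_rate1 :: "(real \<Rightarrow> real) \<Rightarrow> (real \<Rightarrow> real) \<Rightarrow> real \<Rightarrow> real \<Rightarrow> real" where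
  "failure_rate1 F f t1 t2 = f t1 / (F t2 - F t1)"

definition failure_rate2 :: "(real \<Rightarrow> real) \<Rightarrow> (real \<Rightarrow> real) \<Rightarrow> real \<Rightarrow> real \<Rightarrow> real" where
  "failure_rate2 F f t1 t2 = f t2 / (F t2 - F t1)"

text \<open>
  A density is determined only up to null sets, whereas the failure rates use its value at a
  single point. For the uniform distribution on the unit interval, redefining the density at 1
  to be 100 changes no integral but makes a pointwise bound at 1 fail. The following condition
  excludes such spikes: no value of the density at a positive point exceeds the essential upper
  limit of the density at that point. The lemmas below show that it holds at a point if the value there
  is zero, or a left or right limit of the density, or a left or right derivative of the cdf.
\<close>

definition no_null_spike_at :: "(real \<Rightarrow> real) \<Rightarrow> real \<Rightarrow> bool" where
  "no_null_spike_at f t \<longleftrightarrow>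
     (\<forall>c<f t. \<forall>e>0. \<not> (AE s in lborel. s \<in> ball t e \<longrightarrow> f s \<le> c))"

lemma not_AE_interval:
  fixes a b :: real
  assumes "a < b"
  shows "\<not> (AE s in lborel. s \<notin> {a<..<b})"
proof
  assume "AE s in lborel. s \<notin> {a<..<b}"
  then have "emeasure lborel {a<..<b} = 0"
    by (subst (asm) AE_iff_measurable[of "{a<..<b}"]) auto
  with assms show False by simp
qed

lemma no_null_spike_at_zero:
  assumes "\<And>x. 0 \<le> f x" "f t = 0"
  shows "no_null_spike_at f t"
  unfolding no_null_spike_at_def
proof (intro allI impI notI)
  fix c e :: real
  assume c: "c < f t" and e: "0 < e" and ae: "AE s in lborel. s \<in> ball t e \<longrightarrow> f s \<le> c"
  from ae have "AE s in lborel. s \<notin> {t<..<t + e}"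
  proof eventually_elim
    case (elim s)
    then show ?case
      using assms(1)[of s] assms(2) c by (auto simp: dist_real_def)
  qed
  with not_AE_interval[of t "t + e"] e show False by simp
qed

lemma no_null_spike_at_continuous_right:
  assumes "continuous (at_right t) f"
  shows "no_null_spike_at f t"
  unfolding no_null_spike_at_def
proof (intro allI impI notI)
  fix c e :: real
  assume c: "c < f t" and e: "0 < e" and ae: "AE s in lborel. s \<in> ball t e \<longrightarrow> f s \<le> c"
  have "eventually (\<lambda>s. c < f s) (at_right t)"
    using assms c by (auto simp: continuous_within intro: order_tendstoD)
  then obtain b where b: "b > t" "\<And>s. t < s \<Longrightarrow> s < b \<Longrightarrow> c < f s"
    by (auto simp: eventually_at_right_field)
  from ae have "AE s in lborel. s \<notin> {t<..<min b (t + e)}"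
  proof eventually_elim
    case (elim s)
    then show ?case using b(2)[of s] by (auto simp: dist_real_def)
  qed
  with not_AE_interval[of t "min b (t + e)"] b e show False by simp
qed

lemma no_null_spike_at_continuous_left:
  assumes "continuous (at_left t) f"
  shows "no_null_spike_at f t"
  unfolding no_null_spike_at_def
proof (intro allI impI notI)
  fix c e :: real
  assume c: "c < f t" and e: "0 < e" and ae: "AE s in lborel. s \<in> ball t e \<longrightarrow> f s \<le> c"
  have "eventually (\<lambda>s. c < f s) (at_left t)"
    using assms c by (auto simp: continuous_within intro: order_tendstoD)
  then obtain b where b: "b < t" "\<And>s. b < s \<Longrightarrow> s < t \<Longrightarrow> c < f s"
    by (auto simp: eventually_at_left_field)
  from ae have "AE s in lborel. s \<notin> {max b (t - e)<..<t}"
  proof eventually_elim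
    case (elim s)
    then show ?case using b(2)[of s] by (auto simp: dist_real_def)
  qed
  with not_AE_interval[of "max b (t - e)" t] b e show False by simp
qed

lemma (in prob_space) cdf_diff_le:
  assumes dens: "distributed M lborel X (\<lambda>x. ennreal (f x))" and "a \<le> b" "0 \<le> c"
    and ae: "AE s in lborel. s \<in> {a<..b} \<longrightarrow> f s \<le> c"
  shows "cdf (distr M borel X) b - cdf (distr M borel X) a \<le> c * (b - a)"
proof -
  have X: "X \<in> borel_measurable M"
    using distributed_measurable[OF dens] by simp
  interpret D: real_distribution "distr M borel X"
    using X by (intro real_distribution_distr) 
  have m: "{a<..b} \<in> sets lborel" by simp
  have "emeasure (distr M borel X) {a<..b} = emeasure M (X -` {a<..b} \<inter> space M)"
    using X by (simp add: emeasure_distr)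
  also have "\<dots> = (\<integral>\<^sup>+s. ennreal (f s) * indicator {a<..b} s \<partial>lborel)"
    by (rule distributed_emeasure[OF dens m])
  also have "\<dots> \<le> (\<integral>\<^sup>+s. ennreal c * indicator {a<..b} s \<partial>lborel)"
    using ae by (intro nn_integral_mono_AE)
      (auto elim!: eventually_mono split: split_indicator intro: ennreal_leI)
  also have "\<dots> = ennreal (c * (b - a))"
    using assms by (simp add: nn_integral_cmult_indicator ennreal_mult'')
  finally have "measure (distr M borel X) {a<..b} \<le> c * (b - a)"
    using assms by (simp add: D.emeasure_eq_measure)
  then show ?thesis
    using \<open>a \<le> b\<close> by (cases "a = b") (simp_all add: D.cdf_diff_eq)
qed

lemma (in prob_space) no_null_spike_at_derivative_right:
  assumes dens: "distributed M lborel X (\<lambda>x. ennreal (f x))" and nn: "\<And>x. 0 \<le> f x"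
    and der: "(cdf (distr M borel X) has_real_derivative f t) (at_right t)"
  shows "no_null_spike_at f t"
proof (cases "f t = 0")
  case True
  then show ?thesis using nn no_null_spike_at_zero by blast
next
  case False
  show ?thesis
    unfolding no_null_spike_at_def
  proof (intro allI impI notI)
    fix c e :: real
    assume c: "c < f t" and e: "0 < e" and ae: "AE s in lborel. s \<in> ball t e \<longrightarrow> f s \<le> c"
    let ?F = "cdf (distr M borel X)"
    have ft: "0 < f t" using False nn[of t] by simp
    have "eventually (\<lambda>s. s \<in> {t<..<t + e}) (at_right t)"
      using e by (intro eventually_at_right_real) simp
    then have "eventually (\<lambda>s. (?F s - ?F t) / (s - t) \<le> max c 0) (at_right t)"
    proof eventually_elim
      case (elim s)
      have "AE x in lborel. x \<in> {t<..s} \<longrightarrow> f x \<le> max c 0"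
        using ae by eventually_elim (use elim in \<open>auto simp: dist_real_def\<close>)
      from cdf_diff_le[OF dens _ _ this] elim show ?case
        by (simp add: divide_le_eq)
    qed
    moreover have "((\<lambda>s. (?F s - ?F t) / (s - t)) \<longlongrightarrow> f t) (at_right t)"
      using der by (simp add: has_field_derivative_iff)
    ultimately have "f t \<le> max c 0"
      by (intro tendsto_upperbound) auto
    with c ft show False by simp
  qed
qed

lemma (in prob_space) no_null_spike_at_derivative_left:
  assumes dens: "distributed M lborel X (\<lambda>x. ennreal (f x))" and nn: "\<And>x. 0 \<le> f x"
    and der: "(cdf (distr M borel X) has_real_derivative f t) (at_left t)"
  shows "no_null_spike_at f t"
proof (cases "f t = 0")
  case True
  then show ?thesis using nn no_null_spike_at_zero by blast
next
  case False
  show ?thesis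
    unfolding no_null_spike_at_def
  proof (intro allI impI notI)
    fix c e :: real
    assume c: "c < f t" and e: "0 < e" and ae: "AE s in lborel. s \<in> ball t e \<longrightarrow> f s \<le> c"
    let ?F = "cdf (distr M borel X)"
    have ft: "0 < f t" using False nn[of t] by simp
    have ae': "AE x in lborel. x \<in> ball t e \<longrightarrow> f x \<le> max c 0"
      using ae by eventually_elim auto
    have "eventually (\<lambda>s. s \<in> {t - e<..<t}) (at_left t)"
      using e by (intro eventually_at_left_real) simp
    then have "eventually (\<lambda>s. (?F s - ?F t) / (s - t) \<le> max c 0) (at_left t)"
    proof eventually_elim
      case (elim s)
      have "AE x in lborel. x \<noteq> t" by (rule AE_lborel_singleton)
      with ae' have "AE x in lborel. x \<in> {s<..t} \<longrightarrow> f x \<le> max c 0"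
        by eventually_elim (use elim in \<open>auto simp: dist_real_def\<close>)
      from cdf_diff_le[OF dens _ _ this] elim
      have "(?F t - ?F s) / (t - s) \<le> max c 0"
        by (simp add: divide_le_eq)
      also have "(?F t - ?F s) / (t - s) = (?F s - ?F t) / (s - t)"
        by (metis minus_diff_eq minus_divide_divide)
      finally show ?case .
    qed
    moreover have "((\<lambda>s. (?F s - ?F t) / (s - t)) \<longlongrightarrow> f t) (at_left t)"
      using der by (simp add: has_field_derivative_iff)
    ultimately have "f t \<le> max c 0"
      by (intro tendsto_upperbound) auto
    with c ft show False by simp
  qed
qed

end

theory Submission imports Defs begin

text \<open>
  Fix \<open>t1\<close> and write \<open>G t = F t - F t1\<close> and \<open>I t\<close> for the integral of the squared density from
  \<open>t1\<close> to \<open>t\<close>, so that the interval extropy is \<open>- I / (2 G\<^sup>2)\<close>. Formally, monotonicity says that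
  \<open>I / G\<^sup>2\<close> has nonpositive derivative, that is \<open>f\<^sup>2 G \<le> 2 I f\<close>, which is the claim. As the
  derivatives exist only almost everywhere, one argues by contradiction: if \<open>f t2 > c > 2 I t2 / G t2\<close>,
  then monotonicity makes the integral of \<open>f\<^sup>2 - c f\<close> nonpositive over all short intervals near
  \<open>t2\<close>, so \<open>f \<le> c\<close> almost everywhere near \<open>t2\<close> by Lebesgue differentiation, and \<open>f\<close> has a
  null spike at \<open>t2\<close>.
\<close>

text \<open>By Lebesgue differentiation, outside a negligible set \<open>g x\<close> is the limit of
  the averages of \<open>g\<close> over \<open>{x..x + r}\<close> as \<open>r\<close> shrinks to 0,
  and these averages are nonpositive once \<open>x + r < b\<close>.\<close>

lemma AE_nonpos_if_integral_nonpos: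
  fixes g :: "real \<Rightarrow> real"
  assumes int: "g integrable_on {a..b}"
    and nonpos: "\<And>s u. a < s \<Longrightarrow> s < u \<Longrightarrow> u < b \<Longrightarrow> integral {s..u} g \<le> 0"
  shows "AE x in lborel. x \<in> {a<..<b} \<longrightarrow> g x \<le> 0"
proof -
  \<comment> \<open>The differentiation theorem is stated for functions integrable on every box,
    hence the extension of \<open>g\<close> by zero.\<close>
  define h where "h x = (if x \<in> {a..b} then g x else 0)" for x
  have "h integrable_on UNIV"
    unfolding h_def using int by (subst integrable_restrict_UNIV) auto
  then have "h integrable_on cbox u v" for u v
    by (rule integrable_on_subcbox) auto
  then obtain N where N: "negligible N" and lim: "\<And>x e. x \<notin> N \<Longrightarrow> 0 < e \<Longrightarrow>
      \<exists>d>0. \<forall>r. 0 < r \<and> r < d \<longrightarrow>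
        norm (integral (cbox x (x + r *\<^sub>R One)) h /\<^sub>R r ^ DIM(real) - h x) < e"
    using integrable_ccontinuous_explicit by metis
  have le: "g x \<le> 0" if x: "x \<in> {a<..<b}" "x \<notin> N" for x
  proof (rule ccontr)
    assume "\<not> g x \<le> 0"
    then have pos: "0 < g x" by simp
    from lim[OF x(2) pos] obtain d where d: "d > 0"
      "\<And>r. 0 < r \<Longrightarrow> r < d \<Longrightarrow> \<bar>integral {x..x + r} h / r - h x\<bar> < g x"
      by (auto simp: divide_inverse mult.commute)
    define r where "r = min d (b - x) / 2"
    have r: "0 < r" "r < d" "x + r < b"
      using d(1) x(1) by (auto simp: r_def min_def field_simps)
    have "integral {x..x + r} h = integral {x..x + r} g"
      using x(1) r by (intro integral_cong) (auto simp: h_def)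
    also have "\<dots> \<le> 0" using x(1) r by (intro nonpos) auto
    finally have "integral {x..x + r} h / r \<le> 0"
      using r(1) by (simp add: divide_le_0_iff)
    moreover have "h x = g x" using x(1) by (simp add: h_def)
    ultimately show False using d(2)[OF r(1,2)] by linarith
  qed
  have "AE x in lborel. x \<notin> N"
    using N AE_not_in[of N lebesgue] by (simp add: negligible_iff_null_sets AE_completion_iff)
  then show ?thesis by eventually_elim (use le in auto)
qed

text \<open>The analytic core, free of probability. Monotonicity of the extropy enters as
  \<open>decr\<close> with denominators cleared; \<open>b\<close> lies beyond \<open>t\<close>
  because a null spike is tested on both sides of \<open>t\<close>.\<close>

lemma density_times_integral_le:
  fixes f :: "real \<Rightarrow> real" and a b t :: real
  defines "G \<equiv> \<lambda>u. integral {a..u} f" and "I \<equiv> \<lambda>u. integral {a..u} (\<lambda>x. (f x)\<^sup>2)"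
  assumes t: "a < t" "t < b" and nn: "\<And>x. 0 \<le> f x"
    and int: "f integrable_on {a..b}" and int2: "(\<lambda>x. (f x)\<^sup>2) integrable_on {a..b}"
    and G: "0 < G t"
    and decr: "\<And>s u. a < s \<Longrightarrow> s \<le> u \<Longrightarrow> u < b \<Longrightarrow> 0 < G s \<Longrightarrow> I u * (G s)\<^sup>2 \<le> I s * (G u)\<^sup>2"
    and spike: "no_null_spike_at f t"
  shows "f t * G t \<le> 2 * I t"
proof (rule ccontr)
  assume "\<not> ?thesis"
  then have "2 * I t / G t < f t" using G by (simp add: field_simps)
  \<comment> \<open>The strict gap on both sides of \<open>c\<close> matters: the lower one survives
    small perturbations of \<open>t\<close>, the upper one contradicts the spike condition.\<close>
  then obtain c where c: "2 * I t / G t < c" "c < f t" using dense by blast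
  have sub: "f integrable_on {u..v}" "(\<lambda>x. (f x)\<^sup>2) integrable_on {u..v}"
    if "a \<le> u" "v \<le> b" for u v
    using int int2 that by (auto intro: integrable_on_subinterval)
  have subc: "(\<lambda>x. c * f x) integrable_on {u..v}" if "a \<le> u" "v \<le> b" for u v
    using integrable_cmul[OF sub(1)[OF that], of c] by simp
  have split: "G u - G s = integral {s..u} f" "I u - I s = integral {s..u} (\<lambda>x. (f x)\<^sup>2)"
    if "a \<le> s" "s \<le> u" "u \<le> b" for s u
    using Henstock_Kurzweil_Integration.integral_combine[of a s u f]
      Henstock_Kurzweil_Integration.integral_combine[of a s u "\<lambda>x. (f x)\<^sup>2"] that sub[of a u]
    by (auto simp: G_def I_def)
  have mono: "G s \<le> G u" "I s \<le> I u" if "a \<le> s" "s \<le> u" "u \<le> b" for s u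
  proof -
    have "0 \<le> integral {s..u} f" "0 \<le> integral {s..u} (\<lambda>x. (f x)\<^sup>2)"
      using sub[of s u] that nn by (auto intro!: integral_nonneg)
    with split[OF that] show "G s \<le> G u" "I s \<le> I u" by linarith+
  qed
  have nonneg: "0 \<le> G u" "0 \<le> I u" if "a \<le> u" "u \<le> b" for u
    using mono[of a u] that by (auto simp: G_def I_def)
  have "0 \<le> 2 * I t / G t" using G nonneg[of t] t by simp
  with c(1) have c0: "0 < c" by linarith
  have cont: "isCont G t" "isCont I t"
    using indefinite_integral_continuous_1[OF int] indefinite_integral_continuous_1[OF int2] t
    by (auto simp: G_def I_def intro!: continuous_on_interior)
  have "((\<lambda>e. t - e) \<longlongrightarrow> t) (at_right 0)" "((\<lambda>e. t + e) \<longlongrightarrow> t) (at_right 0)"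
    by (auto intro!: tendsto_eq_intros)
  note tends = isCont_tendsto_compose[OF cont(1) this(1)]
    isCont_tendsto_compose[OF cont(1) this(2)] isCont_tendsto_compose[OF cont(2) this(2)]
  \<comment> \<open>This is the worst case over \<open>s\<close> and \<open>u\<close> within
    distance \<open>e\<close> of \<open>t\<close>: as \<open>G\<close> and \<open>I\<close> are
    monotone, the term with \<open>c\<close> is smallest at the left end and the other one largest
    at the right end.\<close>
  have "((\<lambda>e. c * (G (t - e))\<^sup>2 - 2 * I (t + e) * G (t + e)) \<longlongrightarrow>
      c * (G t)\<^sup>2 - 2 * I t * G t) (at_right 0)"
    by (intro tendsto_intros tends)
  moreover have "0 < c * (G t)\<^sup>2 - 2 * I t * G t"
  proof -
    have "2 * I t < c * G t" using c(1) G by (simp add: field_simps)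
    then have "2 * I t * G t < c * G t * G t" using G by (rule mult_strict_right_mono)
    then show ?thesis by (simp add: power2_eq_square)
  qed
  ultimately have "\<forall>\<^sub>F e in at_right 0. 0 < c * (G (t - e))\<^sup>2 - 2 * I (t + e) * G (t + e)"
    by (rule order_tendstoD)
  moreover have "\<forall>\<^sub>F e in at_right 0. 0 < G (t - e)"
    using tends(1) G by (rule order_tendstoD)
  moreover have "\<forall>\<^sub>F e in at_right 0. e \<in> {0<..<min (t - a) (b - t)}"
    using t by (intro eventually_at_right_real) auto
  ultimately have "\<forall>\<^sub>F e in at_right 0. 0 < c * (G (t - e))\<^sup>2 - 2 * I (t + e) * G (t + e) \<and>
      0 < G (t - e) \<and> e \<in> {0<..<min (t - a) (b - t)}"
    by eventually_elim auto
  then obtain e where e: "2 * I (t + e) * G (t + e) < c * (G (t - e))\<^sup>2" "0 < G (t - e)"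
      "0 < e" "e < t - a" "e < b - t"
    using eventually_happens'[OF trivial_limit_at_right_real] by fastforce
  have "AE x in lborel. x \<in> {t - e<..<t + e} \<longrightarrow> (f x)\<^sup>2 - c * f x \<le> 0"
  proof (rule AE_nonpos_if_integral_nonpos)
    show "(\<lambda>x. (f x)\<^sup>2 - c * f x) integrable_on {t - e..t + e}"
      using e by (intro integrable_diff sub subc) auto
  next
    fix s u assume su: "t - e < s" "s < u" "u < t + e"
    have Gs: "0 < G s" using mono(1)[of "t - e" s] e su by simp
    \<comment> \<open>Subtracting \<open>I s * (G s)\<^sup>2\<close> from both sides of
      \<open>decr\<close> isolates the increment of \<open>I\<close>; the difference of squares then
      supplies the factor \<open>G u - G s\<close>.\<close>
    have "(I u - I s) * (G s)\<^sup>2 \<le> I s * ((G u)\<^sup>2 - (G s)\<^sup>2)"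
      using decr[of s u] Gs e su by (simp add: algebra_simps)
    also have "\<dots> = (G u - G s) * (I s * (G u + G s))"
      by (simp add: algebra_simps power2_eq_square)
    also have "\<dots> \<le> (G u - G s) * (c * (G s)\<^sup>2)"
    proof (rule mult_left_mono)
      have "I s * (G u + G s) \<le> I (t + e) * (G (t + e) + G (t + e))"
        using mono[of s "t + e"] mono[of u "t + e"] nonneg[of s] nonneg[of u] nonneg[of "t + e"] e su
        by (intro mult_mono add_mono) auto
      also have "\<dots> \<le> c * (G (t - e))\<^sup>2" using e(1) by simp
      also have "\<dots> \<le> c * (G s)\<^sup>2"
        using mono(1)[of "t - e" s] e su c0 by (intro mult_left_mono power_mono) auto
      finally show "I s * (G u + G s) \<le> c * (G s)\<^sup>2" .
      show "0 \<le> G u - G s" using mono(1)[of s u] e su by simp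
    qed
    finally have "(I u - I s) * (G s)\<^sup>2 \<le> (c * (G u - G s)) * (G s)\<^sup>2"
      by (simp add: algebra_simps)
    \<comment> \<open>The discrete form of \<open>f\<^sup>2 \<le> c f\<close> on
      \<open>{s..u}\<close>, ready for Lebesgue differentiation.\<close>
    then have "I u - I s \<le> c * (G u - G s)"
      by (rule mult_right_le_imp_le) (use Gs in simp)
    then show "integral {s..u} (\<lambda>x. (f x)\<^sup>2 - c * f x) \<le> 0"
      using sub[of s u] subc[of s u] split[of s u] e su
      by (subst integral_diff) auto
  qed
  then have "AE x in lborel. x \<in> ball t e \<longrightarrow> f x \<le> c"
  proof eventually_elim
    case (elim x)
    show ?case
    proof
      assume "x \<in> ball t e"
      then have "f x * f x \<le> c * f x"
        using elim by (auto simp: dist_real_def power2_eq_square)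
      \<comment> \<open>Where \<open>f x\<close> vanishes it cannot be cancelled, and
        \<open>0 < c\<close> is used instead.\<close>
      then show "f x \<le> c" using nn[of x] c0 by (cases "f x = 0") auto
    qed
  qed
  with spike c(2) e(3) show False unfolding no_null_spike_at_def by blast
qed

lemma (in prob_space) cdf_diff_has_integral:
  assumes dens: "distributed M lborel X (\<lambda>x. ennreal (f x))" and nn: "\<And>x. 0 \<le> f x"
    and "a \<le> b"
  shows "(f has_integral cdf (distr M borel X) b - cdf (distr M borel X) a) {a..b}"
proof -
  have X: "X \<in> borel_measurable M"
    using distributed_measurable[OF dens] by simp
  interpret D: real_distribution "distr M borel X"
    using X by (intro real_distribution_distr)
  have meas: "(\<lambda>x. enn2real (ennreal (f x))) \<in> borel_measurable borel"
    using distributed_borel_measurable[OF dens] by measurable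
  then have [measurable]: "f \<in> borel_measurable borel" using nn by simp
  let ?d = "cdf (distr M borel X) b - cdf (distr M borel X) a"
  have d: "?d = measure (distr M borel X) {a<..b}"
    using \<open>a \<le> b\<close> by (cases "a = b") (simp_all add: D.cdf_diff_eq)
  have "ennreal ?d = emeasure (distr M borel X) {a<..b}"
    by (simp add: d D.emeasure_eq_measure)
  also have "\<dots> = emeasure M (X -` {a<..b} \<inter> space M)"
    using X by (simp add: emeasure_distr)
  also have "\<dots> = (\<integral>\<^sup>+x. ennreal (f x) * indicator {a<..b} x \<partial>lborel)"
    by (rule distributed_emeasure[OF dens]) simp
  \<comment> \<open>Increments of the cdf live on half-open intervals; adding the endpoint
    \<open>a\<close> changes only a null set.\<close>
  also have "\<dots> = (\<integral>\<^sup>+x. ennreal (f x * indicator {a..b} x) \<partial>lborel)"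
    using AE_lborel_singleton[of a]
    by (intro nn_integral_cong_AE) (auto elim!: eventually_mono split: split_indicator)
  finally have "((\<lambda>x. f x * indicator {a..b} x) has_integral ?d) UNIV"
    using nn d by (intro nn_integral_has_integral) auto
  also have "(\<lambda>x. f x * indicator {a..b} x) = (\<lambda>x. if x \<in> {a..b} then f x else 0)"
    by (auto simp: fun_eq_iff)
  finally show ?thesis by (simp only: has_integral_restrict_UNIV)
qed

text \<open>Links the extended integral in \<open>interval_extropy\<close> to the gauge integral
  used in the differentiation argument.\<close>

lemma integrable_on_if_nn_integral_finite:
  fixes g :: "real \<Rightarrow> real"
  assumes [measurable]: "g \<in> borel_measurable borel" "S \<in> sets borel" and nn: "\<And>x. 0 \<le> g x"
    and fin: "(\<integral>\<^sup>+x\<in>S. ennreal (g x) \<partial>lborel) < \<infinity>"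
  shows "g integrable_on S" "(\<integral>\<^sup>+x\<in>S. ennreal (g x) \<partial>lborel) = ennreal (integral S g)"
proof -
  obtain r where r: "0 \<le> r" "(\<integral>\<^sup>+x\<in>S. ennreal (g x) \<partial>lborel) = ennreal r"
    using fin by (cases "\<integral>\<^sup>+x\<in>S. ennreal (g x) \<partial>lborel" rule: ennreal_cases) auto
  have "(\<integral>\<^sup>+x. ennreal (g x * indicator S x) \<partial>lborel) = ennreal r"
    unfolding r(2)[symmetric] by (intro nn_integral_cong) (simp split: split_indicator)
  then have "((\<lambda>x. g x * indicator S x) has_integral r) UNIV"
    using nn r(1) by (intro nn_integral_has_integral) auto
  also have "(\<lambda>x. g x * indicator S x) = (\<lambda>x. if x \<in> S then g x else 0)"
    by (auto simp: fun_eq_iff)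
  finally have "(g has_integral r) S" by (simp only: has_integral_restrict_UNIV)
  then show "g integrable_on S" "(\<integral>\<^sup>+x\<in>S. ennreal (g x) \<partial>lborel) = ennreal (integral S g)"
    using r(2) by (auto simp: integral_unique)
qed

theorem theorem2:
  fixes M :: "'a measure" and X :: "'a \<Rightarrow> real" and f F :: "real \<Rightarrow> real"
  assumes "prob_space M"
    and "AE \<omega> in M. 0 \<le> X \<omega>"
    and "distributed M lborel X (\<lambda>x. ennreal (f x))"
    and "\<And>x. 0 \<le> f x"
    and "\<And>t. 0 < t \<Longrightarrow> no_null_spike_at f t"
    and "F = cdf (distr M borel X)"
    and "\<And>t1. mono_on {t2. (t1, t2) \<in> extropy_domain F} (interval_extropy F f t1)"
  shows "\<forall>(t1, t2) \<in> extropy_domain F.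
           interval_extropy F f t1 t2 \<le> ereal (- failure_rate2 F f t1 t2 / 4)"
proof clarify
  fix t1 t2 assume dom: "(t1, t2) \<in> extropy_domain F"
  interpret prob_space M by fact
  let ?N = "\<lambda>u. \<integral>\<^sup>+x\<in>{t1..u}. ennreal ((f x)\<^sup>2) \<partial>lborel"
  let ?I = "\<lambda>u. integral {t1..u} (\<lambda>x. (f x)\<^sup>2)"
  have "(\<lambda>x. enn2real (ennreal (f x))) \<in> borel_measurable borel"
    using distributed_borel_measurable[OF assms(3)] by measurable
  then have [measurable]: "f \<in> borel_measurable borel" using assms(4) by simp
  have intf: "(f has_integral F u - F s) {s..u}" if "s \<le> u" for s u
    unfolding assms(6) using assms(3,4) that by (rule cdf_diff_has_integral)
  have F_mono: "F s \<le> F u" if "s \<le> u" for s u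
    using has_integral_nonneg[OF intf[OF that]] assms(4) by simp
  have t: "0 \<le> t1" "F t1 < F t2" using dom by (auto simp: extropy_domain_def)
  then have t12: "t1 < t2" using F_mono[of t2 t1] by linarith
  show "interval_extropy F f t1 t2 \<le> ereal (- failure_rate2 F f t1 t2 / 4)"
  \<comment> \<open>If the squared density has infinite integral up to \<open>t2\<close>, the
    extropy is minus infinity and the bound is trivial.\<close>
  proof (cases "?N t2 = \<infinity>")
    case True
    then have "interval_extropy F f t1 t2 = - \<infinity>"
      using t(2) by (simp add: interval_extropy_def)
    then show ?thesis by simp
  next
    case False
    have extropy: "interval_extropy F f t1 u = ereal (- (?I u / (2 * (F u - F t1)\<^sup>2)))"
      if "?N u < \<infinity>" for u
    proof -
      have "?N u = ennreal (?I u)" "0 \<le> ?I u"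
        using integrable_on_if_nn_integral_finite[of "\<lambda>x. (f x)\<^sup>2" "{t1..u}"] that
        by (auto intro!: integral_nonneg)
      then show ?thesis by (simp add: interval_extropy_def)
    qed
    \<comment> \<open>Integrability is needed to the right of \<open>t2\<close> too. There
      monotonicity supplies it: the extropy at \<open>u\<close> is at least the finite one at
      \<open>t2\<close>, so it is not minus infinity.\<close>
    have fin: "?N u < \<infinity>" for u
    proof (cases "u \<le> t2")
      case True
      have "?N u \<le> ?N t2"
        using True by (intro nn_integral_mono) (auto split: split_indicator)
      with False show ?thesis by (simp add: top.not_eq_extremum le_less_trans)
    next
      case u: False
      have domu: "(t1, u) \<in> extropy_domain F"
        using F_mono[of t2 u] u t t12 by (auto simp: extropy_domain_def)
      have "interval_extropy F f t1 t2 \<le> interval_extropy F f t1 u"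
        using mono_onD[OF assms(7)] dom domu u by simp
      moreover have "interval_extropy F f t1 t2 \<noteq> - \<infinity>"
        using extropy[of t2] False by (simp add: top.not_eq_extremum)
      ultimately have "interval_extropy F f t1 u \<noteq> - \<infinity>" by auto
      moreover have "interval_extropy F f t1 u = - \<infinity>" if "?N u = \<infinity>"
        using that domu by (simp add: interval_extropy_def extropy_domain_def)
      ultimately show ?thesis by (metis infinity_ennreal_def top.not_eq_extremum)
    qed
    have G: "integral {t1..u} f = F u - F t1" if "t1 \<le> u" for u
      using intf[OF that] by (rule integral_unique)
    have "f t2 * integral {t1..t2} f \<le> 2 * ?I t2"
    \<comment> \<open>The number \<open>t2 + 1\<close> is an arbitrary point to the right of
      \<open>t2\<close>.\<close>
    proof (rule density_times_integral_le[where b = "t2 + 1"])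
      show "f integrable_on {t1..t2 + 1}" using intf[of t1 "t2 + 1"] t12 by auto
      show "(\<lambda>x. (f x)\<^sup>2) integrable_on {t1..t2 + 1}"
        using fin by (intro integrable_on_if_nn_integral_finite) auto
      show "no_null_spike_at f t2" using t t12 by (intro assms(5)) simp
      show "0 < integral {t1..t2} f" using G[of t2] t t12 by simp
      fix s u assume su: "t1 < s" "s \<le> u" and pos: "0 < integral {t1..s} f"
      have Fs: "F t1 < F s" "F s \<le> F u" using pos G[of s] su F_mono[of s u] by auto
      then have "interval_extropy F f t1 s \<le> interval_extropy F f t1 u"
        using su t by (intro mono_onD[OF assms(7)]) (auto simp: extropy_domain_def)
      \<comment> \<open>The minus sign in the extropy reverses the inequality: the quotient
        decreases.\<close>
      then have "?I u / (2 * (F u - F t1)\<^sup>2) \<le> ?I s / (2 * (F s - F t1)\<^sup>2)"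
        by (simp add: extropy[OF fin])
      then show "?I u * (integral {t1..s} f)\<^sup>2 \<le> ?I s * (integral {t1..u} f)\<^sup>2"
        using Fs su by (simp add: G field_simps)
    qed (use t12 assms(4) in auto)
    then have "f t2 * (F t2 - F t1) \<le> 2 * ?I t2" using G[of t2] t12 by simp
    \<comment> \<open>The factor 4 combines the 2 of the core inequality with the 2 in the
      denominator of the extropy.\<close>
    then have "f t2 * (F t2 - F t1) / (4 * (F t2 - F t1)\<^sup>2) \<le> 2 * ?I t2 / (4 * (F t2 - F t1)\<^sup>2)"
      by (rule divide_right_mono) simp
    then have "f t2 / (F t2 - F t1) / 4 \<le> ?I t2 / (2 * (F t2 - F t1)\<^sup>2)"
      using t(2) by (simp add: power2_eq_square mult.commute)
    then show ?thesis by (simp add: extropy[OF fin] failure_rate2_def)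
  qed
qed

end
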